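(* Let $n=2$ and $\alpha\ge1$. If a value setting or a cost setting is monotone and $\alpha$-single crossing, then there is no $\alpha$-deterministic conflict pair. The converse does not hold when $\alpha>1$.
   Context: There are $n=2$ agents with signals $s_1,s_2\in[k]=\{1,\dots,k\}$. A value setting is a pair of functions $v_1,v_2:[k]^2\to\mathbb R_{>0}$; a cost setting is a pair of functions $c_1,c_2:[k]^2\to\mathbb R_{>0}$. For agent $i$, $\mathbf s_{-i}$ denotes the other agent's signal. Monotone: in a value setting, each $v_i$ is non-decreasing in each signal; in a cost setting, each $c_i$ is non-increasing in each signal. $\alpha$-single crossing: a value setting is $\alpha$-single crossing if for all $i$, all $\mathbf s$, all $\tilde s_i\ge s_i$ and $j\ne i$, $\alpha\,(v_i(\tilde s_i,\mathbf s_{-i})-v_i(s_i,\mathbf s_{-i}))\ge v_j(\tilde s_i,\mathbf s_{-i})-v_j(s_i,\mathbf s_{-i})$. A cost setting is $\alpha$-single crossing if for all $i$, all $\mathbf s$, all $\tilde s_i\ge s_i$ and $j\ne i$, $\alpha\,(c_i(\tilde s_i,\mathbf s_{-i})-c_i(s_i,\mathbf s_{-i}))\le c_j(\tilde s_i,\mathbf s_{-i})-c_j(s_i,\mathbf s_{-i})$. Performance ratios: $\rho_i(\mathbf s)=\frac{v_i(\mathbf s)}{\max_j v_j(\mathbf s)}$ in the value setting, $\rho_i(\mathbf s)=\frac{\min_j c_j(\mathbf s)}{c_i(\mathbf s)}$ in the cost setting. Signal orders: $\sigma_i(\mathbf s_{-i})=\{(s_i,s_i')\in[k]^2: v_i(s_i,\mathbf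 s_{-i})<v_i(s_i',\mathbf s_{-i})\}$ (value) or $\{(s_i,s_i')\in[k]^2:c_i(s_i,\mathbf s_{-i})>c_i(s_i',\mathbf s_{-i})\}$ (cost). Relation $\prec$: consider the directed graph on $[k]^2$ with an edge $(s_1,s_2)\to(s_1',s_2)$ whenever $(s_1,s_1')\in\sigma_1(s_2)$, and an edge $(s_1,s_2')\to(s_1,s_2)$ whenever $(s_2,s_2')\in\sigma_2(s_1)$. (These edges encode the monotonicity constraints on $x_1=1-x_2$ required for truthfulness.) For distinct profiles, $(s_1,s_2)\prec(s_1',s_2')$ means that there is a directed path from $(s_1,s_2)$ to $(s_1',s_2')$. $\alpha$-deterministic conflict pair: a pair $(s_1,s_2)\prec(s_1',s_2')$ with $\min\left(\frac1{\rho_2(s_1,s_2)},\frac1{\rho_1(s_1',s_2')}\right)>\alpha$. *)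

theory Defs
  imports Complex_Main
begin

text \<open>
  The agents are the numbers 1 and 2, and the signal space is \<open>{1..k}\<close>. A profile is a pair
  \<open>(s\<^sub>1, s\<^sub>2)\<close>, and \<open>v i s\<close> is the value (or cost) of agent \<open>i\<close> at the profile \<open>s\<close>.
  Functions are total in HOL; only their values for agents in \<open>{1, 2}\<close> and profiles in
  \<open>{1..k} \<times> {1..k}\<close> are ever constrained or used.
\<close>

type_synonym profile = "nat \<times> nat"
type_synonym valuation = "nat \<Rightarrow> profile \<Rightarrow> real"

abbreviation agents :: "nat set" where
  "agents \<equiv> {1, 2}"

text \<open>\<open>prof i a b\<close> is the profile \<open>(s\<^sub>i, s\<^sub>-\<^sub>i) = (a, b)\<close>.\<close>

definition prof :: "nat \<Rightarrow> nat \<Rightarrow> nat \<Rightarrow> profile" where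
  "prof i a b = (if i = 1 then (a, b) else (b, a))"

text \<open>Value settings and cost settings are subject to the same condition, positivity.\<close>

definition setting :: "nat \<Rightarrow> valuation \<Rightarrow> bool" where
  "setting k v \<longleftrightarrow> (\<forall>i\<in>agents. \<forall>s\<in>{1..k} \<times> {1..k}. v i s > 0)"

definition value_monotone :: "nat \<Rightarrow> valuation \<Rightarrow> bool" where
  "value_monotone k v \<longleftrightarrow>
     (\<forall>i\<in>agents. \<forall>m\<in>agents. \<forall>b\<in>{1..k}. \<forall>a\<in>{1..k}. \<forall>a'\<in>{1..k}.
        a \<le> a' \<longrightarrow> v i (prof m a b) \<le> v i (prof m a' b))"

definition cost_monotone :: "nat \<Rightarrow> valuation \<Rightarrow> bool" where
  "cost_monotone k c \<longleftrightarrow>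
     (\<forall>i\<in>agents. \<forall>m\<in>agents. \<forall>b\<in>{1..k}. \<forall>a\<in>{1..k}. \<forall>a'\<in>{1..k}.
        a \<le> a' \<longrightarrow> c i (prof m a b) \<ge> c i (prof m a' b))"

definition value_single_crossing :: "real \<Rightarrow> nat \<Rightarrow> valuation \<Rightarrow> bool" where
  "value_single_crossing \<alpha> k v \<longleftrightarrow>
     (\<forall>i\<in>agents. \<forall>j\<in>agents. j \<noteq> i \<longrightarrow>
        (\<forall>b\<in>{1..k}. \<forall>a\<in>{1..k}. \<forall>a'\<in>{1..k}. a' \<ge> a \<longrightarrow>
           \<alpha> * (v i (prof i a' b) - v i (prof i a b)) \<ge> v j (prof i a' b) - v j (prof i a b)))"

definition cost_single_crossing :: "real \<Rightarrow> nat \<Rightarrow> valuation \<Rightarrow> bool" where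
  "cost_single_crossing \<alpha> k c \<longleftrightarrow>
     (\<forall>i\<in>agents. \<forall>j\<in>agents. j \<noteq> i \<longrightarrow>
        (\<forall>b\<in>{1..k}. \<forall>a\<in>{1..k}. \<forall>a'\<in>{1..k}. a' \<ge> a \<longrightarrow>
           \<alpha> * (c i (prof i a' b) - c i (prof i a b)) \<le> c j (prof i a' b) - c j (prof i a b)))"

definition value_ratio :: "valuation \<Rightarrow> nat \<Rightarrow> profile \<Rightarrow> real" where
  "value_ratio v i s = v i s / Max ((\<lambda>j. v j s) ` agents)"

definition cost_ratio :: "valuation \<Rightarrow> nat \<Rightarrow> profile \<Rightarrow> real" where
  "cost_ratio c i s = Min ((\<lambda>j. c j s) ` agents) / c i s"

text \<open>The signal orders \<open>\<sigma>\<^sub>i(s\<^sub>-\<^sub>i)\<close>; the last argument \<open>b\<close> is the other agent's signal.\<close>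

definition value_order :: "nat \<Rightarrow> valuation \<Rightarrow> nat \<Rightarrow> nat \<Rightarrow> (nat \<times> nat) set" where
  "value_order k v i b =
     {(a, a'). a \<in> {1..k} \<and> a' \<in> {1..k} \<and> v i (prof i a b) < v i (prof i a' b)}"

definition cost_order :: "nat \<Rightarrow> valuation \<Rightarrow> nat \<Rightarrow> nat \<Rightarrow> (nat \<times> nat) set" where
  "cost_order k c i b =
     {(a, a'). a \<in> {1..k} \<and> a' \<in> {1..k} \<and> c i (prof i a b) > c i (prof i a' b)}"

text \<open>
  Both settings build the graph from their signal orders \<open>\<sigma>\<close> in the same way. An edge for agent 1
  goes from the worse to the better signal, an edge for agent 2 from the better to the worse one,
  since the allocation probabilities satisfy \<open>x\<^sub>1 = 1 - x\<^sub>2\<close>.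
\<close>

definition edges :: "nat \<Rightarrow> (nat \<Rightarrow> nat \<Rightarrow> (nat \<times> nat) set) \<Rightarrow> (profile \<times> profile) set" where
  "edges k \<sigma> =
     {((s1, s2), (s1', s2)) | s1 s1' s2. s2 \<in> {1..k} \<and> (s1, s1') \<in> \<sigma> 1 s2} \<union>
     {((s1, s2'), (s1, s2)) | s1 s2 s2'. s1 \<in> {1..k} \<and> (s2, s2') \<in> \<sigma> 2 s1}"

definition prec :: "nat \<Rightarrow> (nat \<Rightarrow> nat \<Rightarrow> (nat \<times> nat) set) \<Rightarrow> profile \<Rightarrow> profile \<Rightarrow> bool" where
  "prec k \<sigma> s t \<longleftrightarrow> s \<noteq> t \<and> (s, t) \<in> (edges k \<sigma>)\<^sup>+"

definition value_conflict_pair :: "real \<Rightarrow> nat \<Rightarrow> valuation \<Rightarrow> profile \<Rightarrow> profile \<Rightarrow> bool" where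
  "value_conflict_pair \<alpha> k v s t \<longleftrightarrow>
     prec k (value_order k v) s t \<and>
     min (1 / value_ratio v 2 s) (1 / value_ratio v 1 t) > \<alpha>"

definition cost_conflict_pair :: "real \<Rightarrow> nat \<Rightarrow> valuation \<Rightarrow> profile \<Rightarrow> profile \<Rightarrow> bool" where
  "cost_conflict_pair \<alpha> k c s t \<longleftrightarrow>
     prec k (cost_order k c) s t \<and>
     min (1 / cost_ratio c 2 s) (1 / cost_ratio c 1 t) > \<alpha>"

end

(* Monotonicity makes the first signal weakly increase and the second one weakly decrease along
   every directed path, so a pair s \<prec> t spans a rectangle. For values, at s = (a, b) a conflict
   forces v1 > \<alpha> v2; lowering the second signal to that of t keeps v1 > \<alpha> v2 by single crossing
   for agent 2. This implies \<alpha> v1 > v2, which is kept by single crossing for agent 1 when the first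
   signal is then raised to that of t, whereas a conflict forces v2 > \<alpha> v1 at t. For costs one
   passes through the opposite corner of the rectangle. For the converse, let agent 1 have constant
   value and let the value of agent 2 grow by a factor \<alpha> with the first signal: this violates single
   crossing, but all ratios stay within \<alpha>. *)

theory Submission
  imports Defs
begin

lemma prof_simps [simp]: "prof 1 a b = (a, b)" "prof (Suc 0) a b = (a, b)" "prof 2 a b = (b, a)"
  by (simp_all add: prof_def)

text \<open>Kept abstract in \<open>\<sigma>\<close> so that both settings can use it: the
  assumptions ask only that the signal orders respect \<open>\<le>\<close>. The reversed edges of
  agent 2 turn this into a decrease of the second signal.\<close>

lemma edges_trancl_monotone:
  assumes less1: "\<And>b a a'. b \<in> {1..k} \<Longrightarrow> (a, a') \<in> \<sigma> 1 b \<Longrightarrow> a \<in> {1..k} \<and> a' \<in> {1..k} \<and> a \<le> a'"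
    and less2: "\<And>b a a'. b \<in> {1..k} \<Longrightarrow> (a, a') \<in> \<sigma> 2 b \<Longrightarrow> a \<in> {1..k} \<and> a' \<in> {1..k} \<and> a \<le> a'"
    and path: "(s, t) \<in> (edges k \<sigma>)\<^sup>+"
  shows "s \<in> {1..k} \<times> {1..k} \<and> t \<in> {1..k} \<times> {1..k} \<and> fst s \<le> fst t \<and> snd t \<le> snd s"
proof -
  have edge: "x \<in> {1..k} \<times> {1..k} \<and> y \<in> {1..k} \<times> {1..k} \<and> fst x \<le> fst y \<and> snd y \<le> snd x"
    if "(x, y) \<in> edges k \<sigma>" for x y
  proof -
    from that consider (first) a a' b where "x = (a, b)" "y = (a', b)" "b \<in> {1..k}" "(a, a') \<in> \<sigma> 1 b"
      | (second) a b b' where "x = (a, b')" "y = (a, b)" "a \<in> {1..k}" "(b, b') \<in> \<sigma> 2 a"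
      unfolding edges_def by blast
    then show ?thesis
    proof cases
      case first
      with less1[of b a a'] show ?thesis by simp
    next
      case second
      with less2[of a b b'] show ?thesis by simp
    qed
  qed
  show ?thesis
    using path
  proof (induction rule: trancl_induct)
    case (base y)
    then show ?case by (rule edge)
  next
    case (step y z)
    then show ?case using edge[of y z] by (meson le_trans)
  qed
qed

lemma value_order_le:
  assumes "value_monotone k v" "i \<in> agents" "b \<in> {1..k}" "(a, a') \<in> value_order k v i b"
  shows "a \<in> {1..k} \<and> a' \<in> {1..k} \<and> a \<le> a'"
proof -
  have a: "a \<in> {1..k}" "a' \<in> {1..k}" "v i (prof i a b) < v i (prof i a' b)"
    using assms(4) by (auto simp: value_order_def)
  then have "\<not> a' \<le> a"
    using assms(1-3) unfolding value_monotone_def by (meson not_less)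
  with a show ?thesis by simp
qed

lemma cost_order_le:
  assumes "cost_monotone k c" "i \<in> agents" "b \<in> {1..k}" "(a, a') \<in> cost_order k c i b"
  shows "a \<in> {1..k} \<and> a' \<in> {1..k} \<and> a \<le> a'"
proof -
  have a: "a \<in> {1..k}" "a' \<in> {1..k}" "c i (prof i a b) > c i (prof i a' b)"
    using assms(4) by (auto simp: cost_order_def)
  then have "\<not> a' \<le> a"
    using assms(1-3) unfolding cost_monotone_def by (meson not_less)
  with a show ?thesis by simp
qed

text \<open>The inverse ratio is the maximum divided by \<open>v i s\<close>. As
  \<open>\<alpha> \<ge> 1\<close>, the entry \<open>v i s\<close> itself can never exceed
  \<open>\<alpha> * v i s\<close>, so only the other agent's value matters.\<close>

lemma less_inverse_value_ratio_iff:
  assumes "\<alpha> \<ge> 1" "i \<in> agents" "j \<in> agents" "i \<noteq> j" "v i s > 0"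
  shows "\<alpha> < 1 / value_ratio v i s \<longleftrightarrow> \<alpha> * v i s < v j s"
proof -
  have "v i s \<le> \<alpha> * v i s" using assms(1,5) by simp
  moreover have "value_ratio v i s = v i s / max (v i s) (v j s)"
    using assms(2-4) by (auto simp: value_ratio_def max.commute)
  then have "\<alpha> < 1 / value_ratio v i s \<longleftrightarrow> \<alpha> * v i s < max (v i s) (v j s)"
    using assms(5) by (simp add: less_divide_eq)
  ultimately show ?thesis by linarith
qed

text \<open>If the minimum is \<open>c i s\<close>, both sides are false, since multiplying a
  positive cost by \<open>\<alpha> \<ge> 1\<close> cannot make it smaller.\<close>

lemma less_inverse_cost_ratio_iff:
  assumes "\<alpha> \<ge> 1" "i \<in> agents" "j \<in> agents" "i \<noteq> j" "c i s > 0" "c j s > 0"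
  shows "\<alpha> < 1 / cost_ratio c i s \<longleftrightarrow> \<alpha> * c j s < c i s"
proof -
  have "c i s \<le> \<alpha> * c i s" "c j s \<le> \<alpha> * c j s" using assms(1,5,6) by simp_all
  moreover have "cost_ratio c i s = min (c i s) (c j s) / c i s"
    using assms(2-4) by (auto simp: cost_ratio_def min.commute)
  then have "\<alpha> < 1 / cost_ratio c i s \<longleftrightarrow> \<alpha> * min (c i s) (c j s) < c i s"
    using assms(5,6) by (simp add: less_divide_eq)
  ultimately show ?thesis by (auto simp only: min_def split: if_splits)
qed

text \<open>From \<open>x \<le> \<alpha> * x < y \<le> \<alpha> * y\<close>. At the corner of the
  rectangle this moves \<open>\<alpha>\<close> to the other agent, as the second use of single
  crossing requires.\<close>

lemma less_scale_if_scale_less: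
  fixes \<alpha> x y :: real
  assumes "\<alpha> \<ge> 1" "x > 0" "\<alpha> * x < y"
  shows "x < \<alpha> * y"
proof -
  have x: "x \<le> \<alpha> * x" using assms(1,2) by simp
  then have "0 < y" using assms(2,3) by linarith
  then have "y \<le> \<alpha> * y" using assms(1) by simp
  with x show ?thesis using assms(3) by linarith
qed

lemma no_value_conflict_pair_if_single_crossing:
  assumes "\<alpha> \<ge> 1" "setting k v" "value_monotone k v" "value_single_crossing \<alpha> k v"
  shows "\<not> value_conflict_pair \<alpha> k v s t"
proof
  assume conflict: "value_conflict_pair \<alpha> k v s t"
  obtain a b a' b' where st: "s = (a, b)" "t = (a', b')" by (metis surj_pair)
  have "s \<in> {1..k} \<times> {1..k} \<and> t \<in> {1..k} \<times> {1..k} \<and> fst s \<le> fst t \<and> snd t \<le> snd s"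
    using conflict value_order_le[OF assms(3)]
    by (intro edges_trancl_monotone[where \<sigma> = "value_order k v"])
      (auto simp: value_conflict_pair_def prec_def)
  then have range: "a \<in> {1..k}" "b \<in> {1..k}" "a' \<in> {1..k}" "b' \<in> {1..k}" "a \<le> a'" "b' \<le> b"
    by (auto simp: st)
  have pos: "v i (x, y) > 0" if "i \<in> agents" "x \<in> {1..k}" "y \<in> {1..k}" for i x y
    using assms(2) that by (auto simp: setting_def)
  have at_s: "\<alpha> * v 2 (a, b) < v 1 (a, b)"
    using conflict less_inverse_value_ratio_iff[OF assms(1), of 2 1 v "(a, b)"] pos range
    by (auto simp: value_conflict_pair_def st)
  have at_t: "\<alpha> * v 1 (a', b') < v 2 (a', b')"
    using conflict less_inverse_value_ratio_iff[OF assms(1), of 1 2 v "(a', b')"] pos range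
    by (auto simp: value_conflict_pair_def st)
  \<comment> \<open>Equivalently, \<open>v 1 - \<alpha> * v 2\<close> does not increase with the
    second signal, so it stays positive when \<open>b\<close> drops to \<open>b'\<close>.\<close>
  have "\<alpha> * (v 2 (prof 2 b a) - v 2 (prof 2 b' a)) \<ge> v 1 (prof 2 b a) - v 1 (prof 2 b' a)"
    using assms(4) range unfolding value_single_crossing_def by fastforce
  with at_s have "\<alpha> * v 2 (a, b') < v 1 (a, b')"
    by (simp add: algebra_simps)
  then have "v 2 (a, b') < \<alpha> * v 1 (a, b')"
    using less_scale_if_scale_less assms(1) pos range by simp
  \<comment> \<open>Here \<open>\<alpha> * v 1 - v 2\<close> does not decrease with the first
    signal, so it is still positive at \<open>t\<close>, against \<open>at_t\<close>.\<close>
  moreover have "\<alpha> * (v 1 (prof 1 a' b') - v 1 (prof 1 a b')) \<ge> v 2 (prof 1 a' b') - v 2 (prof 1 a b')"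
    using assms(4) range unfolding value_single_crossing_def by fastforce
  ultimately show False
    using at_t by (simp add: algebra_simps)
qed

lemma no_cost_conflict_pair_if_single_crossing:
  assumes "\<alpha> \<ge> 1" "setting k c" "cost_monotone k c" "cost_single_crossing \<alpha> k c"
  shows "\<not> cost_conflict_pair \<alpha> k c s t"
proof
  assume conflict: "cost_conflict_pair \<alpha> k c s t"
  obtain a b a' b' where st: "s = (a, b)" "t = (a', b')" by (metis surj_pair)
  have "s \<in> {1..k} \<times> {1..k} \<and> t \<in> {1..k} \<times> {1..k} \<and> fst s \<le> fst t \<and> snd t \<le> snd s"
    using conflict cost_order_le[OF assms(3)]
    by (intro edges_trancl_monotone[where \<sigma> = "cost_order k c"])
      (auto simp: cost_conflict_pair_def prec_def)
  then have range: "a \<in> {1..k}" "b \<in> {1..k}" "a' \<in> {1..k}" "b' \<in> {1..k}" "a \<le> a'" "b' \<le> b"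
    by (auto simp: st)
  have pos: "c i (x, y) > 0" if "i \<in> agents" "x \<in> {1..k}" "y \<in> {1..k}" for i x y
    using assms(2) that by (auto simp: setting_def)
  have at_s: "\<alpha> * c 1 (a, b) < c 2 (a, b)"
    using conflict less_inverse_cost_ratio_iff[OF assms(1), of 2 1 c "(a, b)"] pos range
    by (auto simp: cost_conflict_pair_def st)
  have at_t: "\<alpha> * c 2 (a', b') < c 1 (a', b')"
    using conflict less_inverse_cost_ratio_iff[OF assms(1), of 1 2 c "(a', b')"] pos range
    by (auto simp: cost_conflict_pair_def st)
  \<comment> \<open>For costs the first signal moves first: \<open>c 2 - \<alpha> * c 1\<close> does
    not decrease with it, and \<open>at_s\<close> makes it positive.\<close>
  have "\<alpha> * (c 1 (prof 1 a' b) - c 1 (prof 1 a b)) \<le> c 2 (prof 1 a' b) - c 2 (prof 1 a b)"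
    using assms(4) range unfolding cost_single_crossing_def by fastforce
  with at_s have "\<alpha> * c 1 (a', b) < c 2 (a', b)"
    by (simp add: algebra_simps)
  then have "c 1 (a', b) < \<alpha> * c 2 (a', b)"
    using less_scale_if_scale_less assms(1) pos range by simp
  \<comment> \<open>Now \<open>c 1 - \<alpha> * c 2\<close> does not decrease with the second
    signal, so being negative at \<open>(a', b)\<close> it is negative at \<open>t\<close>.\<close>
  moreover have "\<alpha> * (c 2 (prof 2 b a') - c 2 (prof 2 b' a')) \<le> c 1 (prof 2 b a') - c 1 (prof 2 b' a')"
    using assms(4) range unfolding cost_single_crossing_def by fastforce
  ultimately show False
    using at_t by (simp add: algebra_simps)
qed

text \<open>With fewer than two signals all differences in the condition vanish and single crossing
  is automatic, hence \<open>k \<ge> 2\<close>.\<close>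

lemma value_single_crossing_not_necessary:
  fixes \<alpha> :: real
  assumes "\<alpha> > 1" "k \<ge> 2"
  shows "\<exists>v. setting k v \<and> value_monotone k v \<and>
    \<not> (\<exists>s t. value_conflict_pair \<alpha> k v s t) \<and> \<not> value_single_crossing \<alpha> k v"
proof -
  define v :: valuation where "v i s = (if i = 2 \<and> fst s \<noteq> 1 then \<alpha> else 1)" for i s
  have "setting k v" "value_monotone k v"
    using assms by (auto simp: v_def setting_def value_monotone_def prof_def)
  \<comment> \<open>A conflict needs both inverse ratios above \<open>\<alpha>\<close>, so bounding
    that of agent 1 suffices. It may equal \<open>\<alpha>\<close>, but the comparison is
    strict.\<close>
  moreover have "\<not> \<alpha> < 1 / value_ratio v 1 t" for t
    using assms less_inverse_value_ratio_iff[of \<alpha> 1 2 v t] by (simp add: v_def)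
  then have "\<not> (\<exists>s t. value_conflict_pair \<alpha> k v s t)"
    by (simp add: value_conflict_pair_def)
  moreover have "\<not> value_single_crossing \<alpha> k v"
  proof
    assume "value_single_crossing \<alpha> k v"
    then have "\<alpha> * (v 1 (prof 1 2 1) - v 1 (prof 1 1 1)) \<ge> v 2 (prof 1 2 1) - v 2 (prof 1 1 1)"
      using assms(2) unfolding value_single_crossing_def by fastforce
    then show False using assms(1) by (simp add: v_def)
  qed
  ultimately show ?thesis by blast
qed

lemma cost_single_crossing_not_necessary:
  fixes \<alpha> :: real
  assumes "\<alpha> > 1" "k \<ge> 2"
  shows "\<exists>c. setting k c \<and> cost_monotone k c \<and>
    \<not> (\<exists>s t. cost_conflict_pair \<alpha> k c s t) \<and> \<not> cost_single_crossing \<alpha> k c"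
proof -
  \<comment> \<open>The cost of agent 2 falls from \<open>\<alpha>\<close> to 1 when the first
    signal leaves 1, while agent 1 stays constant and is always cheapest.\<close>
  define c :: valuation where "c i s = (if i = 2 \<and> fst s = 1 then \<alpha> else 1)" for i s
  have "setting k c" "cost_monotone k c"
    using assms by (auto simp: c_def setting_def cost_monotone_def prof_def)
  moreover have "\<not> \<alpha> < 1 / cost_ratio c 1 t" for t
    using assms less_inverse_cost_ratio_iff[of \<alpha> 1 2 c t] less_1_mult[of \<alpha> \<alpha>]
    by (auto simp: c_def split: if_splits)
  then have "\<not> (\<exists>s t. cost_conflict_pair \<alpha> k c s t)"
    by (simp add: cost_conflict_pair_def)
  moreover have "\<not> cost_single_crossing \<alpha> k c"
  proof
    assume "cost_single_crossing \<alpha> k c"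
    then have "\<alpha> * (c 1 (prof 1 2 1) - c 1 (prof 1 1 1)) \<le> c 2 (prof 1 2 1) - c 2 (prof 1 1 1)"
      using assms(2) unfolding cost_single_crossing_def by fastforce
    then show False using assms(1) by (simp add: c_def)
  qed
  ultimately show ?thesis by blast
qed

theorem proposition4p14:
  fixes k :: nat and \<alpha> :: real
  assumes "\<alpha> \<ge> 1"
  shows "(\<forall>v. setting k v \<and> value_monotone k v \<and> value_single_crossing \<alpha> k v \<longrightarrow>
            \<not> (\<exists>s t. value_conflict_pair \<alpha> k v s t)) \<and>
         (\<forall>c. setting k c \<and> cost_monotone k c \<and> cost_single_crossing \<alpha> k c \<longrightarrow>
            \<not> (\<exists>s t. cost_conflict_pair \<alpha> k c s t)) \<and>
         (\<alpha> > 1 \<and> k \<ge> 2 \<longrightarrow>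
            (\<exists>v. setting k v \<and> value_monotone k v \<and>
                 \<not> (\<exists>s t. value_conflict_pair \<alpha> k v s t) \<and> \<not> value_single_crossing \<alpha> k v) \<and>
            (\<exists>c. setting k c \<and> cost_monotone k c \<and>
                 \<not> (\<exists>s t. cost_conflict_pair \<alpha> k c s t) \<and> \<not> cost_single_crossing \<alpha> k c))"
  using no_value_conflict_pair_if_single_crossing[OF assms]
    no_cost_conflict_pair_if_single_crossing[OF assms]
    value_single_crossing_not_necessary[of \<alpha> k] cost_single_crossing_not_necessary[of \<alpha> k]
  by blast

end
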